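(* There exist a $2$-$(459,9,4)$ design and a $2$-$(783,9,4)$ design.
   Context: A $2$-$(v,k,\lambda)$ design is a pair $(V,\mathcal{A})$ where $V$ is a set of $v$ points and $\mathcal{A}$ is a collection (multiset) of $k$-subsets of $V$ (blocks) such that every $2$-subset of $V$ is contained in exactly $\lambda$ blocks of $\mathcal{A}$. *)

theory Defs
  imports Main "HOL-Library.Multiset"
begin

text \<open>Blocks form a multiset, so repeated blocks are allowed and counted with multiplicity.\<close>

definition two_design :: "nat \<Rightarrow> nat \<Rightarrow> nat \<Rightarrow> 'a set \<Rightarrow> 'a set multiset \<Rightarrow> bool" where
  "two_design v k l V \<A> \<longleftrightarrow>
     finite V \<and> card V = v \<and>
     (\<forall>B \<in># \<A>. B \<subseteq> V \<and> card B = k) \<and>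
     (\<forall>P. P \<subseteq> V \<and> card P = 2 \<longrightarrow> size {#B \<in># \<A>. P \<subseteq> B#} = l)"

end

theory Submission
  imports Defs "HOL-Library.Numeral_Type" "HOL-Library.Product_Plus"
begin

text \<open>
  Let \<open>G = (\<int>/3)\<^sup>3\<close> and let \<open>q\<close> be 17 or 29, so that the number of points is \<open>27 q\<close>. There are three blocks
  of size 9 in \<open>G \<times> \<int>/q\<close> such that, for every \<open>g \<in> G\<close>, exactly eight of their differences have first
  component \<open>g\<close>, and the second components of these are four nonzero squares and four nonsquares.
  Multiplying the second components by all nonzero squares spreads each such square (nonsquare) over
  all the squares (nonsquares), so every difference \<open>(g, z)\<close> with \<open>z \<noteq> 0\<close> arises exactly four times
  and no nonzero difference \<open>(g, 0)\<close> arises at all. Translating by \<open>G \<times> \<int>/q\<close> therefore covers every pair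
  of points with distinct second components four times. The pairs inside a coset \<open>G \<times> {c}\<close> are covered
  by the planes of AG(3,3), which form a 2-(27,9,4) design.
\<close>

section \<open>Designs from difference families\<close>

lemma size_filter_mset_sum:
  "size (filter_mset P (\<Sum>i\<in>I. M i)) = (\<Sum>i\<in>I. size (filter_mset P (M i)))"
  by (induction I rule: infinite_finite_induct) auto

lemma size_filter_mset_sum_list:
  "size (filter_mset P (\<Sum>i\<leftarrow>is. M i)) = (\<Sum>i\<leftarrow>is. size (filter_mset P (M i)))"
  by (induction "is") auto

lemma size_filter_image_mset_set:
  "finite I \<Longrightarrow> size (filter_mset P (image_mset f (mset_set I))) = card {i \<in> I. P (f i)}"
  by (simp add: filter_mset_image_mset)

lemma in_sum_list_mset: "x \<in># (\<Sum>i\<leftarrow>is. M i) \<longleftrightarrow> (\<exists>i\<in>set is. x \<in># M i)"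
  by (induction "is") auto

lemma in_sum_mset: "finite I \<Longrightarrow> x \<in># (\<Sum>i\<in>I. M i) \<longleftrightarrow> (\<exists>i\<in>I. x \<in># M i)"
  by (induction I rule: finite_induct) auto

section \<open>The design condition for pairs of points, and relabelling of points\<close>

lemma two_designI:
  assumes "finite V" "card V = v"
    and "\<And>B. B \<in># A \<Longrightarrow> B \<subseteq> V \<and> card B = k"
    and "\<And>x y. x \<in> V \<Longrightarrow> y \<in> V \<Longrightarrow> x \<noteq> y \<Longrightarrow> size {#B \<in># A. {x, y} \<subseteq> B#} = l"
  shows "two_design v k l V A"
  unfolding two_design_def
proof (intro conjI ballI allI impI)
  fix P assume P: "P \<subseteq> V \<and> card P = 2"
  then obtain x y where "P = {x, y}" "x \<noteq> y" by (meson card_2_iff)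
  with P assms(4) show "size {#B \<in># A. P \<subseteq> B#} = l" by blast
qed (use assms in auto)

lemma two_designD:
  assumes "two_design v k l V A"
  shows "finite V" "card V = v" "B \<in># A \<Longrightarrow> B \<subseteq> V" "B \<in># A \<Longrightarrow> card B = k"
    and "x \<in> V \<Longrightarrow> y \<in> V \<Longrightarrow> x \<noteq> y \<Longrightarrow> size {#B \<in># A. {x, y} \<subseteq> B#} = l"
proof -
  show "size {#B \<in># A. {x, y} \<subseteq> B#} = l" if "x \<in> V" "y \<in> V" "x \<noteq> y"
  proof -
    have "{x, y} \<subseteq> V \<and> card {x, y} = 2" using that by auto
    with assms show ?thesis unfolding two_design_def by blast
  qed
qed (use assms in \<open>auto simp: two_design_def\<close>)

lemma two_design_image:
  assumes "two_design v k l V A" "inj_on f V"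
  shows "two_design v k l (f ` V) (image_mset ((`) f) A)"
proof (rule two_designI)
  note D = two_designD[OF assms(1)]
  show "finite (f ` V)" "card (f ` V) = v"
    using D assms(2) by (auto simp: card_image)
  show "B \<subseteq> f ` V \<and> card B = k" if B: "B \<in># image_mset ((`) f) A" for B
  proof -
    obtain C where C: "C \<in># A" "B = f ` C" using B by auto
    with D(3,4)[of C] assms(2) show ?thesis
      by (auto simp: card_image inj_on_subset)
  qed
  fix x y assume "x \<in> f ` V" "y \<in> f ` V" "x \<noteq> y"
  then obtain x' y' where xy: "x' \<in> V" "y' \<in> V" "x = f x'" "y = f y'" "x' \<noteq> y'"
    by blast
  have "{x, y} \<subseteq> f ` B \<longleftrightarrow> {x', y'} \<subseteq> B" if "B \<in># A" for B
    using D(3)[OF that] assms(2) xy by (auto simp: inj_on_def)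
  then have "{#B \<in># A. {x, y} \<subseteq> f ` B#} = {#B \<in># A. {x', y'} \<subseteq> B#}"
    by (intro filter_mset_cong) auto
  then show "size {#B \<in># image_mset ((`) f) A. {x, y} \<subseteq> B#} = l"
    using D(5)[of x' y'] xy by (simp add: filter_mset_image_mset)
qed

section \<open>Differences and translates of base blocks\<close>

text \<open>A block of size \<open>k\<close> contributes, besides its \<open>k (k - 1)\<close> proper differences, also \<open>k\<close> zeros.\<close>

definition differences :: "'a::ab_group_add list \<Rightarrow> 'a list" where
  "differences B = map (\<lambda>(a, b). a - b) (List.product B B)"

lemma in_set_differences: "d \<in> set (differences B) \<longleftrightarrow> (\<exists>a\<in>set B. \<exists>b\<in>set B. d = a - b)"
  by (auto simp: differences_def image_iff)

lemma count_list_conv_filter: "count_list xs x = length (filter (\<lambda>y. y = x) xs)"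
  by (induction xs) auto

text \<open>A translate through \<open>x\<close> and \<open>y\<close> comes from \<open>a\<close>,
  \<open>b\<close> in \<open>B\<close> with \<open>x = t + a\<close> and \<open>y = t + b\<close>.
  This forces \<open>a - b = x - y\<close>, and \<open>t = x - a\<close> recovers the translate from
  the pair.\<close>

lemma card_translates_containing_pair:
  fixes x y :: "'a::{ab_group_add, finite}"
  assumes "distinct B"
  shows "card {t. {x, y} \<subseteq> (+) t ` set B} = count_list (differences B) (x - y)"
proof -
  let ?P = "filter (\<lambda>(a, b). a - b = x - y) (List.product B B)"
  have "card {t. {x, y} \<subseteq> (+) t ` set B} = card (set ?P)"
  proof (rule bij_betw_same_card[symmetric], rule bij_betw_imageI)
    show "inj_on (\<lambda>(a, b). x - a) (set ?P)"
    proof (rule inj_onI, clarsimp)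
      fix a b b' assume "a - b = x - y" "a - b' = x - y"
      then show "b = b'" by (metis diff_left_imp_eq)
    qed
    show "(\<lambda>(a, b). x - a) ` set ?P = {t. {x, y} \<subseteq> (+) t ` set B}"
    proof (intro equalityI subsetI)
      fix t assume "t \<in> (\<lambda>(a, b). x - a) ` set ?P"
      then obtain a b where "a \<in> set B" "b \<in> set B" "a - b = x - y" "t = x - a" by auto
      moreover from this have "x = t + a" "y = t + b" by (auto simp: algebra_simps)
      ultimately show "t \<in> {t. {x, y} \<subseteq> (+) t ` set B}" by blast
    next
      fix t assume "t \<in> {t. {x, y} \<subseteq> (+) t ` set B}"
      then obtain a b where "a \<in> set B" "b \<in> set B" "x = t + a" "y = t + b" by auto
      then show "t \<in> (\<lambda>(a, b). x - a) ` set ?P"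
        by (intro image_eqI[of _ _ "(a, b)"]) auto
    qed
  qed
  also have "\<dots> = length ?P"
    using assms by (intro distinct_card distinct_filter distinct_product)
  also have "\<dots> = count_list (differences B) (x - y)"
    by (simp add: differences_def count_list_conv_filter filter_map o_def case_prod_unfold conj_commute)
  finally show ?thesis .
qed

text \<open>Translates of the base blocks cover the pairs with distinct second components; the pairs inside
  a coset \<open>'g \<times> {c}\<close> are left to a copy of the fill design.\<close>

lemma relative_difference_family_imp_two_design:
  fixes Bs :: "('g::{ab_group_add, finite} \<times> 'f::{ab_group_add, finite}) list list"
  assumes blocks: "\<And>B. B \<in> set Bs \<Longrightarrow> distinct B \<and> length B = k"
    and diffs: "\<And>g z. (g, z) \<noteq> (0, 0) \<Longrightarrow>
      count_list (concat (map differences Bs)) (g, z) = (if z = 0 then 0 else l)"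
    and fill: "two_design v k l (UNIV :: 'g set) F"
  shows "\<exists>A. two_design (v * CARD('f)) k l (UNIV :: ('g \<times> 'f) set) A"
proof -
  define A1 where "A1 = (\<Sum>B\<leftarrow>Bs. image_mset (\<lambda>t. (+) t ` set B) (mset_set (UNIV :: ('g \<times> 'f) set)))"
  define A2 where "A2 = (\<Sum>c\<in>(UNIV :: 'f set). image_mset (\<lambda>C. C \<times> {c}) F)"
  have "two_design (v * CARD('f)) k l UNIV (A1 + A2)"
  proof (rule two_designI)
    show "card (UNIV :: ('g \<times> 'f) set) = v * CARD('f)"
      using two_designD(2)[OF fill] by simp
    fix B assume "B \<in># A1 + A2"
    then consider t B' where "B' \<in> set Bs" "B = (+) t ` set B'" | C c where "C \<in># F" "B = C \<times> {c}"
      unfolding A1_def A2_def by (auto simp: in_sum_list_mset in_sum_mset)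
    then show "B \<subseteq> UNIV \<and> card B = k"
    proof cases
      case 1
      then show ?thesis using blocks[of B'] by (simp add: card_image distinct_card)
    next
      case 2
      then show ?thesis using two_designD(4)[OF fill, of C] by (simp add: card_cartesian_product)
    qed
  next
    fix x y :: "'g \<times> 'f" assume "x \<noteq> y"
    obtain g c where x: "x = (g, c)" by force
    obtain g' c' where y: "y = (g', c')" by force
    have "size {#B \<in># A1. {x, y} \<subseteq> B#} = (\<Sum>B\<leftarrow>Bs. count_list (differences B) (x - y))"
      unfolding A1_def size_filter_mset_sum_list
      by (intro arg_cong[of _ _ sum_list] map_cong refl)
        (simp add: size_filter_image_mset_set card_translates_containing_pair blocks del: insert_subset)
    also have "\<dots> = count_list (concat (map differences Bs)) (g - g', c - c')"
      by (simp add: x y count_list_concat o_def)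
    also have "\<dots> = (if c = c' then 0 else l)"
      using \<open>x \<noteq> y\<close> by (subst diffs) (auto simp: x y)
    finally have 1: "size {#B \<in># A1. {x, y} \<subseteq> B#} = (if c = c' then 0 else l)" .
    \<comment> \<open>The copy over \<open>e\<close> contains both points only if
      \<open>e = c = c'\<close>, so at most one summand survives; in that case
      \<open>x \<noteq> y\<close> gives \<open>g \<noteq> g'\<close>.\<close>
    have "size {#B \<in># A2. {x, y} \<subseteq> B#} =
        (\<Sum>e\<in>UNIV. if e = c then if c = c' then l else 0 else 0)"
      unfolding A2_def size_filter_mset_sum
    proof (intro sum.cong refl)
      fix e :: 'f
      have "{#C \<in># F. {x, y} \<subseteq> C \<times> {e}#} =
          (if e = c \<and> c = c' then {#C \<in># F. {g, g'} \<subseteq> C#} else {#})"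
        by (auto simp: x y)
      moreover have "size {#C \<in># F. {g, g'} \<subseteq> C#} = l" if "c = c'"
        using two_designD(5)[OF fill, of g g'] that \<open>x \<noteq> y\<close> by (simp add: x y)
      ultimately show "size {#B \<in># image_mset (\<lambda>C. C \<times> {e}) F. {x, y} \<subseteq> B#} =
          (if e = c then if c = c' then l else 0 else 0)"
        by (simp add: filter_mset_image_mset del: insert_subset)
    qed
    then show "size {#B \<in># A1 + A2. {x, y} \<subseteq> B#} = l"
      using 1 by simp
  qed simp
  then show ?thesis by blast
qed

section \<open>Squares and nonsquares in a finite field\<close>

lemma mult_neq_zero_if_unit:
  fixes a b :: "'a::comm_ring_1"
  assumes "\<exists>a'. a * a' = 1" "b \<noteq> 0"
  shows "a * b \<noteq> 0"
  using assms by (metis mult.assoc mult.commute mult_1 mult_zero_right)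

text \<open>The nonzero squares form a subgroup of index 2 of the unit group, so multiplication by \<open>w\<close>
  carries them onto the coset of \<open>w\<close>.\<close>

lemma card_square_quotients:
  fixes S :: "'f::{comm_ring_1, finite} set"
  assumes inv: "\<And>x::'f. x \<noteq> 0 \<Longrightarrow> \<exists>x'. x * x' = 1"
    and S: "S = (\<lambda>x. x * x) ` (- {0})"
    and card_S: "CARD('f) = 2 * card S + 1"
    and "w \<noteq> 0" "z \<noteq> 0"
  shows "card {s \<in> S. s * w = z} = of_bool (w \<in> S \<longleftrightarrow> z \<in> S)"
proof -
  define N where "N = UNIV - insert 0 S"
  note nz = mult_neq_zero_if_unit[OF inv]
  have inj: "inj_on (\<lambda>s. s * w) S"
  proof (rule inj_onI)
    fix s t assume "s * w = t * w"
    then have "(s - t) * w = 0" by (simp add: algebra_simps)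
    with nz[of "s - t" w] \<open>w \<noteq> 0\<close> show "s = t" by auto
  qed
  have "0 \<notin> S"
  proof
    assume "0 \<in> S"
    then obtain x :: 'f where "x \<in> - {0}" "0 = x * x" unfolding S by blast
    with nz[of x x] show False by simp
  qed
  then have "card N = card S"
    using card_S by (simp add: N_def card_Diff_subset)
  have closed: "s * t \<in> S" if st: "s \<in> S" "t \<in> S" for s t
  proof -
    obtain a b :: 'f where "a \<noteq> 0" "b \<noteq> 0" "s = a * a" "t = b * b"
      using st unfolding S by blast
    then have "a * b \<noteq> 0" "s * t = (a * b) * (a * b)" using nz by (auto simp: ac_simps)
    then show ?thesis by (auto simp: S)
  qed
  have inverse: "\<exists>s'\<in>S. s' * s = 1" if s: "s \<in> S" for s
  proof -
    obtain a where a: "a \<noteq> 0" "s = a * a" using s by (auto simp: S)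
    then obtain a' where a': "a * a' = 1" using inv by blast
    have "(a' * a') * s = (a * a') * (a * a')" unfolding a by (simp only: ac_simps)
    with a' have "(a' * a') * s = 1" by simp
    moreover have "a' \<noteq> 0" using a' by auto
    ultimately show ?thesis unfolding S by blast
  qed
  \<comment> \<open>Only inclusions are checked: \<open>S\<close> is closed under products, and
    \<open>s * w\<close> in \<open>S\<close> would put \<open>w = s' * (s * w)\<close> into
    \<open>S\<close>. Equality follows by counting, from \<open>inj\<close> and
    \<open>card N = card S\<close>.\<close>
  have "(\<lambda>s. s * w) ` S = (if w \<in> S then S else N)"
  proof (cases "w \<in> S")
    case True
    then have "(\<lambda>s. s * w) ` S \<subseteq> S" using closed by auto
    with inj have "(\<lambda>s. s * w) ` S = S"
      by (intro card_subset_eq) (simp_all add: card_image)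
    with True show ?thesis by simp
  next
    case False
    have "s * w \<notin> S" if s: "s \<in> S" for s
    proof
      assume "s * w \<in> S"
      moreover obtain s' where "s' \<in> S" "s' * s = 1" using inverse[OF s] by blast
      ultimately have "s' * (s * w) \<in> S" using closed by blast
      with \<open>s' * s = 1\<close> False show False by (simp flip: mult.assoc)
    qed
    moreover have "s * w \<noteq> 0" if "s \<in> S" for s
      using nz \<open>w \<noteq> 0\<close> \<open>0 \<notin> S\<close> that by metis
    ultimately have "(\<lambda>s. s * w) ` S \<subseteq> N" by (auto simp: N_def)
    with inj \<open>card N = card S\<close> have "(\<lambda>s. s * w) ` S = N"
      by (intro card_subset_eq) (simp_all add: card_image)
    with False show ?thesis by simp
  qed
  then have "z \<in> (\<lambda>s. s * w) ` S \<longleftrightarrow> (w \<in> S \<longleftrightarrow> z \<in> S)"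
    using \<open>z \<noteq> 0\<close> by (auto simp: N_def)
  moreover have "card {s \<in> S. s * w = z} = of_bool (z \<in> (\<lambda>s. s * w) ` S)"
  proof (cases "z \<in> (\<lambda>s. s * w) ` S")
    case True
    then obtain s where "s \<in> S" "z = s * w" by blast
    then have "{s \<in> S. s * w = z} = {s}" using inj by (auto simp: inj_on_def)
    with True show ?thesis by simp
  next
    case False
    then have "{s \<in> S. s * w = z} = {}" by blast
    with False show ?thesis by simp
  qed
  ultimately show ?thesis by simp
qed

section \<open>Expansion of base blocks by the squares\<close>

lemma concat_map_concat: "concat (map f (concat xss)) = concat (map (\<lambda>xs. concat (map f xs)) xss)"
  by (induction xss) auto

lemma differences_map:
  assumes "\<And>a b. f (a - b) = f a - f b"
  shows "differences (map f B) = map f (differences B)"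
  by (simp add: differences_def product_concat_map map_concat o_def assms)

text \<open>Over each \<open>g\<close>, \<open>sq\<close> and \<open>nz\<close> leave
  \<open>l\<close> square and \<open>l\<close> nonsquare differences. Each of them meets a given
  \<open>z \<noteq> 0\<close> of its own class for exactly one multiplier in \<open>S\<close>, and
  never one of the other class.\<close>

lemma two_design_from_strong_difference_family:
  fixes Bs :: "('g::{ab_group_add, finite} \<times> 'f::{comm_ring_1, finite}) list list"
  assumes inv: "\<And>x::'f. x \<noteq> 0 \<Longrightarrow> \<exists>x'. x * x' = 1"
    and S: "S = (\<lambda>x. x * x) ` (- {0})"
    and card_S: "CARD('f) = 2 * card S + 1"
    and blocks: "\<And>B. B \<in> set Bs \<Longrightarrow> distinct (map snd B) \<and> length B = k"
    and sq: "\<And>g. length (filter (\<lambda>d. fst d = g \<and> snd d \<in> S) (concat (map differences Bs))) = l"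
    and nz: "\<And>g. length (filter (\<lambda>d. fst d = g \<and> snd d \<noteq> 0) (concat (map differences Bs))) = 2 * l"
    and fill: "two_design v k l (UNIV :: 'g set) F"
  shows "\<exists>A. two_design (v * CARD('f)) k l (UNIV :: ('g \<times> 'f) set) A"
proof -
  define m :: "'f \<Rightarrow> 'g \<times> 'f \<Rightarrow> 'g \<times> 'f" where "m s = map_prod id ((*) s)" for s
  obtain ss where ss: "set ss = S" "distinct ss"
    using finite_distinct_list[of S] by auto
  define E where "E = concat (map differences Bs)"
  note mult_nz = mult_neq_zero_if_unit[OF inv]
  have S_nz: "s \<noteq> 0" if "s \<in> S" for s using that mult_nz by (auto simp: S)
  have inj_m: "inj (m s)" if "s \<in> S" for s
  proof (rule injI)
    fix x y assume "m s x = m s y"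
    then have "fst x = fst y" "s * (snd x - snd y) = 0"
      by (auto simp: m_def map_prod_def case_prod_unfold algebra_simps)
    with mult_nz[OF S_nz[OF that], of "snd x - snd y"] show "x = y" by (auto simp: prod_eq_iff)
  qed
  \<comment> \<open>Second components are distinct within a block, so equal ones force
    \<open>a = b\<close>.\<close>
  have E_0: "d = (0, 0)" if "d \<in> set E" "snd d = 0" for d
  proof -
    obtain B a b where "B \<in> set Bs" "a \<in> set B" "b \<in> set B" "d = a - b"
      using \<open>d \<in> set E\<close> unfolding E_def set_concat set_map UN_iff bex_simps in_set_differences by blast
    moreover from this \<open>snd d = 0\<close> have "a = b"
      using blocks[of B] by (auto simp: distinct_map dest: inj_onD)
    ultimately show ?thesis by (simp add: zero_prod_def)
  qed
  show ?thesis
  proof (rule relative_difference_family_imp_two_design[OF _ _ fill])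
    let ?Bs = "concat (map (\<lambda>s. map (map (m s)) Bs) ss)"
    show "distinct B \<and> length B = k" if "B \<in> set ?Bs" for B
    proof -
      obtain s B' where "s \<in> S" "B' \<in> set Bs" "B = map (m s) B'" using \<open>B \<in> set ?Bs\<close> ss by auto
      then show ?thesis
        using blocks[of B'] inj_on_subset[OF inj_m[of s] subset_UNIV] by (simp add: distinct_map)
    qed
    fix g :: 'g and z :: 'f assume gz: "(g, z) \<noteq> (0, 0)"
    have "map (\<lambda>s. concat (map differences (map (map (m s)) Bs))) ss = map (\<lambda>s. map (m s) E) ss"
    proof (rule map_cong[OF refl])
      fix s assume "s \<in> set ss"
      then have "differences (map (m s) B) = map (m s) (differences B)" for B
        by (intro differences_map) (auto simp: m_def algebra_simps)
      then show "concat (map differences (map (map (m s)) Bs)) = map (m s) E"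
        by (simp add: E_def map_concat o_def)
    qed
    then have "concat (map differences ?Bs) = concat (map (\<lambda>s. map (m s) E) ss)"
      unfolding concat_map_concat map_map o_def by (rule arg_cong)
    then have "count_list (concat (map differences ?Bs)) (g, z) = (\<Sum>s\<leftarrow>ss. count_list (map (m s) E) (g, z))"
      by (simp add: count_list_concat o_def)
    also have "\<dots> = (\<Sum>s\<in>S. \<Sum>d\<leftarrow>E. of_bool (fst d = g \<and> s * snd d = z))"
    proof -
      have "count_list (map (m s) E) (g, z) = (\<Sum>d\<leftarrow>E. of_bool (fst d = g \<and> s * snd d = z))" for s
        by (induction E) (auto simp: m_def)
      then show ?thesis using ss by (simp add: sum_list_distinct_conv_sum_set)
    qed
    \<comment> \<open>Exchanging the sums lets each difference be treated alone: it counts the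
      multipliers \<open>s\<close> that carry it to \<open>(g, z)\<close>.\<close>
    also have "\<dots> = (\<Sum>d\<leftarrow>E. \<Sum>s\<in>S. of_bool (fst d = g \<and> s * snd d = z))"
      by (induction E) (simp_all add: sum.distrib)
    also have "\<dots> = (\<Sum>d\<leftarrow>E. of_bool (fst d = g) * card {s \<in> S. s * snd d = z})"
    proof (intro arg_cong[of _ _ sum_list] map_cong refl)
      fix d
      show "(\<Sum>s\<in>S. of_bool (fst d = g \<and> s * snd d = z)) =
          (of_bool (fst d = g) * card {s \<in> S. s * snd d = z} :: nat)"
        by (cases "fst d = g") (simp_all add: Int_def)
    qed
    also have "\<dots> = (if z = 0 then 0 else l)"
    proof (cases "z = 0")
      case True
      have "of_bool (fst d = g) * card {s \<in> S. s * snd d = z} = 0" if "d \<in> set E" for d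
      proof (cases "snd d = 0")
        case True
        with E_0[OF that] gz \<open>z = 0\<close> show ?thesis by auto
      next
        case False
        with mult_nz S_nz \<open>z = 0\<close> show ?thesis by auto
      qed
      then show ?thesis using True by (simp cong: map_cong)
    next
      case False
      \<comment> \<open>If \<open>snd d = 0\<close>, no \<open>s\<close> reaches
        \<open>z \<noteq> 0\<close>; otherwise \<open>card_square_quotients\<close> applies.\<close>
      have "of_bool (fst d = g) * card {s \<in> S. s * snd d = z} =
          of_bool (fst d = g \<and> snd d \<noteq> 0 \<and> (snd d \<in> S \<longleftrightarrow> z \<in> S))" for d
        using card_square_quotients[OF inv S card_S _ False, of "snd d"] False
        by (cases "snd d = 0") auto
      then have "(\<Sum>d\<leftarrow>E. of_bool (fst d = g) * card {s \<in> S. s * snd d = z}) =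
          (\<Sum>d\<leftarrow>E. of_bool (fst d = g \<and> snd d \<noteq> 0 \<and> (snd d \<in> S \<longleftrightarrow> z \<in> S)))"
        by (simp only:)
      also have "\<dots> = length (filter (\<lambda>d. fst d = g \<and> snd d \<noteq> 0 \<and> (snd d \<in> S \<longleftrightarrow> z \<in> S)) E)"
        by (induction E) auto
      \<comment> \<open>For \<open>z\<close> in \<open>S\<close> this is \<open>sq\<close>; for a
        nonsquare it is \<open>2 * l - l\<close>.\<close>
      also have "\<dots> = l"
      proof -
        have "length (filter (\<lambda>d. fst d = g \<and> snd d \<noteq> 0) E) =
            length (filter (\<lambda>d. fst d = g \<and> snd d \<in> S) E) +
            length (filter (\<lambda>d. fst d = g \<and> snd d \<noteq> 0 \<and> snd d \<notin> S) E)"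
          using S_nz by (induction E) auto
        moreover have "(fst d = g \<and> snd d \<noteq> 0 \<and> snd d \<in> S) = (fst d = g \<and> snd d \<in> S)" for d
          using S_nz by auto
        ultimately show ?thesis
          using sq[of g] nz[of g] by (cases "z \<in> S") (simp_all add: E_def)
      qed
      finally show ?thesis using False by simp
    qed
    finally show "count_list (concat (map differences ?Bs)) (g, z) = (if z = 0 then 0 else l)" .
  qed
qed

section \<open>The planes of AG(3,3)\<close>

text \<open>The numerals 3, 17 and 29 are odd, so as types they have the form
  \<open>'a bit1\<close>; the list of integer representatives unfolds each universe into an explicit
  set.\<close>

lemma UNIV_bit1: "(UNIV :: 'a::finite bit1 set) = of_int ` set [0..int CARD('a bit1) - 1]"
proof -
  have "x \<in> of_int ` set [0..int CARD('a bit1) - 1]" for x :: "'a bit1"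
  proof (cases x)
    case (of_int z)
    then have "z \<in> set [0..int CARD('a bit1) - 1]" by (simp del: card_bit1)
    then show ?thesis unfolding of_int(1) by (rule imageI)
  qed
  then show ?thesis by (intro equalityI subsetI UNIV_I)
qed

lemma UNIV_3: "(UNIV :: 3 set) = {0, 1, 2}"
  by (subst UNIV_bit1) (simp add: upto.simps del: set_upto)

lemma simps_3:
  "(- 1 :: 3) = 2" "(- 2 :: 3) = 1" "(0 :: 3) \<noteq> 1" "(0 :: 3) \<noteq> 2"
  "(1 :: 3) \<noteq> 0" "(1 :: 3) \<noteq> 2" "(2 :: 3) \<noteq> 0" "(2 :: 3) \<noteq> 1"
  by simp_all

text \<open>Yields 27 ground instances that can be decided by evaluation.\<close>

lemma all_3_cubed: "(\<forall>g :: 3 \<times> 3 \<times> 3. P g) \<longleftrightarrow>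
    (\<forall>a\<in>{0, 1, 2}. \<forall>b\<in>{0, 1, 2}. \<forall>c\<in>{0, 1, 2}. P (a, b, c))"
  by (simp flip: UNIV_3)

fun dot :: "3 \<times> 3 \<times> 3 \<Rightarrow> 3 \<times> 3 \<times> 3 \<Rightarrow> 3" where
  "dot (a, b, c) (x, y, z) = a * x + b * y + c * z"

text \<open>One normal vector for each of the 13 parallel classes of planes of AG(3,3).\<close>

definition normals :: "(3 \<times> 3 \<times> 3) list" where
  "normals = [(0,0,1), (0,1,0), (0,1,1), (0,1,2), (1,0,0), (1,0,1), (1,0,2),
     (1,1,0), (1,1,1), (1,1,2), (1,2,0), (1,2,1), (1,2,2)]"

lemma dot_diff: "dot u (p - q) = dot u p - dot u q"
  by (cases u rule: prod_cases3; cases p rule: prod_cases3; cases q rule: prod_cases3)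
    (simp add: algebra_simps)

lemma card_plane:
  assumes "u \<in> set normals"
  shows "card {p. dot u p = k} = 9"
proof -
  let ?L = "List.product [0, 1, 2 :: 3] (List.product [0, 1, 2 :: 3] [0, 1, 2 :: 3])"
  have "UNIV = set ?L"
    by (simp add: UNIV_3 del: UNIV_Times_UNIV flip: UNIV_Times_UNIV)
  then have "{p. dot u p = k} = set (filter (\<lambda>p. dot u p = k) ?L)"
    unfolding set_filter by (metis UNIV_I)
  also have "card \<dots> = length (filter (\<lambda>p. dot u p = k) ?L)"
    by (intro distinct_card distinct_filter distinct_product) simp_all
  also have "\<dots> = 9"
  proof -
    \<comment> \<open>39 ground cases: 13 normals and 3 values of \<open>k\<close>.\<close>
    have "\<forall>u\<in>set normals. \<forall>k\<in>{0, 1, 2}. length (filter (\<lambda>p. dot u p = k) ?L) = 9"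
      by (simp only: normals_def list.set ball_simps, simp add: simps_3)
    moreover have "k \<in> {0, 1, 2}" unfolding UNIV_3[symmetric] by (rule UNIV_I)
    ultimately show ?thesis using assms by blast
  qed
  finally show ?thesis .
qed

text \<open>In each parallel class one plane passes through \<open>p\<close>, and it contains
  \<open>q\<close> iff its normal is orthogonal to \<open>p - q\<close>; so the blocks through a
  pair are counted by normals.\<close>

lemma planes_two_design:
  "two_design 27 9 4 UNIV
    (\<Sum>u\<leftarrow>normals. image_mset (\<lambda>k. {p. dot u p = k}) (mset_set UNIV))"
proof (rule two_designI)
  show "B \<subseteq> UNIV \<and> card B = 9"
    if "B \<in># (\<Sum>u\<leftarrow>normals. image_mset (\<lambda>k. {p. dot u p = k}) (mset_set UNIV))" for B
    using that card_plane by (auto simp: in_sum_list_mset)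
  fix p q :: "3 \<times> 3 \<times> 3" assume "p \<noteq> q"
  have "card {k. {p, q} \<subseteq> {r. dot u r = k}} = of_bool (dot u (p - q) = 0)" for u
  proof (cases "dot u p = dot u q")
    case True
    then have "{k. {p, q} \<subseteq> {r. dot u r = k}} = {dot u p}" by auto
    with True show ?thesis by (simp add: dot_diff)
  next
    case False
    then have "{k. {p, q} \<subseteq> {r. dot u r = k}} = {}" by auto
    with False show ?thesis by (simp add: dot_diff)
  qed
  then have "size {#B \<in># \<Sum>u\<leftarrow>normals. image_mset (\<lambda>k. {r. dot u r = k}) (mset_set UNIV). {p, q} \<subseteq> B#} =
      (\<Sum>u\<leftarrow>normals. of_bool (dot u (p - q) = 0))"
    by (simp add: size_filter_mset_sum_list size_filter_image_mset_set del: insert_subset)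
  also have "\<dots> = 4"
  proof -
    \<comment> \<open>The normals represent the 13 points of PG(2,3); those orthogonal to a nonzero
      \<open>d\<close> form a line, which has 4 points.\<close>
    have "\<forall>d. d \<noteq> (0, 0, 0) \<longrightarrow> (\<Sum>u\<leftarrow>normals. of_bool (dot u d = 0)) = (4 :: nat)"
      by (simp only: all_3_cubed ball_simps, simp add: normals_def simps_3)
    moreover have "p - q \<noteq> (0, 0, 0)" using \<open>p \<noteq> q\<close> by (simp flip: zero_prod_def)
    ultimately show ?thesis by blast
  qed
  finally show "size {#B \<in># \<Sum>u\<leftarrow>normals. image_mset (\<lambda>k. {r. dot u r = k}) (mset_set UNIV). {p, q} \<subseteq> B#} = 4" .
qed simp_all

section \<open>The base blocks\<close>

lemma UNIV_17: "(UNIV :: 17 set) = {0, 1, 2, 3, 4, 5, 6, 7, 8, 9, 10, 11, 12, 13, 14, 15, 16}"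
  by (subst UNIV_bit1) (simp add: upto.simps del: set_upto)

lemma UNIV_29: "(UNIV :: 29 set) = {0, 1, 2, 3, 4, 5, 6, 7, 8, 9, 10, 11, 12, 13, 14, 15, 16,
    17, 18, 19, 20, 21, 22, 23, 24, 25, 26, 27, 28}"
  by (subst UNIV_bit1) (simp add: upto.simps del: set_upto)

abbreviation squares_17 :: "17 set" where
  "squares_17 \<equiv> {1, 2, 4, 8, 9, 13, 15, 16}"

abbreviation squares_29 :: "29 set" where
  "squares_29 \<equiv> {1, 4, 5, 6, 7, 9, 13, 16, 20, 22, 23, 24, 25, 28}"

lemma image_square_17: "(\<lambda>x. x * x) ` (- {0}) = squares_17"
  unfolding Compl_eq_Diff_UNIV UNIV_17 by auto

lemma image_square_29: "(\<lambda>x. x * x) ` (- {0}) = squares_29"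
  unfolding Compl_eq_Diff_UNIV UNIV_29 by auto

lemma card_squares_17: "CARD(17) = 2 * card squares_17 + 1"
  by (simp add: card_insert_if)

lemma card_squares_29: "CARD(29) = 2 * card squares_29 + 1"
  by (simp add: card_insert_if)

lemma unit_17: "x \<noteq> 0 \<Longrightarrow> \<exists>x'. x * x' = (1 :: 17)"
  \<comment> \<open>By Fermat, \<open>x ^ (q - 2)\<close> is the inverse of \<open>x\<close> modulo
    a prime \<open>q\<close>.\<close>
  using UNIV_I[of x] unfolding UNIV_17 by (intro exI[of _ "x ^ 15"]) auto

lemma unit_29: "x \<noteq> 0 \<Longrightarrow> \<exists>x'. x * x' = (1 :: 29)"
  using UNIV_I[of x] unfolding UNIV_29 by (intro exI[of _ "x ^ 27"]) auto

text \<open>The base blocks below were found by simulated annealing.\<close>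

definition blocks_17 :: "((3 \<times> 3 \<times> 3) \<times> 17) list list" where
  "blocks_17 =
    [[((1,2,0),11), ((1,2,0),14), ((1,1,2),16), ((1,2,1),9), ((2,0,0),6),
      ((0,2,2),2), ((0,0,0),7), ((0,2,2),13), ((1,0,0),1)],
     [((2,2,1),0), ((0,1,2),10), ((1,0,2),15), ((2,1,1),4), ((1,0,0),9),
      ((0,2,2),3), ((2,0,2),11), ((0,2,1),16), ((2,0,2),2)],
     [((2,2,2),16), ((1,2,0),11), ((0,2,1),9), ((1,2,1),2), ((2,0,2),15),
      ((2,2,0),0), ((2,0,0),3), ((1,1,1),5), ((2,0,0),1)]]"

definition blocks_29 :: "((3 \<times> 3 \<times> 3) \<times> 29) list list" where
  "blocks_29 =
    [[((0,1,2),2), ((1,1,1),14), ((0,2,2),1), ((1,0,0),25), ((2,2,0),24),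
      ((0,0,1),28), ((0,1,2),27), ((1,1,1),8), ((2,1,1),18)],
     [((1,2,1),28), ((0,0,2),17), ((2,2,2),9), ((2,2,1),25), ((0,0,1),27),
      ((1,0,1),24), ((1,1,0),0), ((2,0,1),23), ((2,2,2),7)],
     [((2,0,0),20), ((2,1,0),4), ((0,0,2),23), ((1,2,2),1), ((2,1,0),14),
      ((2,0,1),19), ((2,0,2),26), ((2,1,2),12), ((1,1,2),16)]]"

text \<open>The table is kept as a list of rows because the cost of simplifying with list equations grows
  quadratically with the length of the list.\<close>

definition labelled_difference_table ::
    "('f \<Rightarrow> bool) \<Rightarrow> ('g::ab_group_add \<times> 'f::ab_group_add) list list \<Rightarrow> ('g \<times> bool) list list" where
  "labelled_difference_table P Bs =
    concat (map (\<lambda>B. map (\<lambda>a. map (\<lambda>b. (fst a - fst b, P (snd a - snd b))) B) B) Bs)"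

text \<open>Only the truth value of \<open>P\<close> on a second component matters, so the table
  stores this label in its place; a row fixes the minuend \<open>a\<close>.\<close>

lemma length_filter_differences:
  "length (filter (\<lambda>d. fst d = g \<and> P (snd d)) (concat (map differences Bs))) =
    (\<Sum>row\<leftarrow>labelled_difference_table P Bs. length (filter (\<lambda>(h, p). h = g \<and> p) row))"
  unfolding labelled_difference_table_def
  by (induction Bs) (simp_all add: differences_def product_concat_map filter_concat length_concat
      filter_map o_def)

text \<open>A named predicate keeps the quantifier over \<open>g\<close> folded while the table
  argument is evaluated.\<close>

definition uniform_labels :: "nat \<Rightarrow> ((3 \<times> 3 \<times> 3) \<times> bool) list list \<Rightarrow> bool" where
  "uniform_labels n E \<longleftrightarrow> (\<forall>g. (\<Sum>row\<leftarrow>E. length (filter (\<lambda>(h, p). h = g \<and> p) row)) = n)"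

lemma blocks_17_squares:
  "length (filter (\<lambda>d. fst d = g \<and> snd d \<in> squares_17) (concat (map differences blocks_17))) = 4"
proof -
  have "uniform_labels 4 (labelled_difference_table (\<lambda>z. z \<in> squares_17) blocks_17)"
    \<comment> \<open>First evaluate the table, and then instantiate the quantifiers before any further simplification:
      with a symbolic \<open>g\<close> the conditionals of \<open>filter\<close> would multiply exponentially.\<close>
    by (simp add: labelled_difference_table_def blocks_17_def simps_3 zero_prod_def)
      (simp only: uniform_labels_def all_3_cubed ball_simps, simp add: simps_3)
  then show ?thesis
    unfolding uniform_labels_def length_filter_differences[where P = "\<lambda>z. z \<in> squares_17"] by blast
qed

text \<open>The three blocks have \<open>3 * 9 * 8 = 27 * 8\<close> proper differences, 8 for each
  \<open>g\<close>. The form \<open>2 * 4\<close> matches \<open>2 * l\<close> in the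
  construction.\<close>

lemma blocks_17_nonzero:
  "length (filter (\<lambda>d. fst d = g \<and> snd d \<noteq> 0) (concat (map differences blocks_17))) = 2 * 4"
proof -
  have "uniform_labels (2 * 4) (labelled_difference_table (\<lambda>z. z \<noteq> 0) blocks_17)"
    by (simp add: labelled_difference_table_def blocks_17_def simps_3 zero_prod_def)
      (simp only: uniform_labels_def all_3_cubed ball_simps, simp add: simps_3)
  then show ?thesis
    unfolding uniform_labels_def length_filter_differences[where P = "\<lambda>z. z \<noteq> 0"] by blast
qed

lemma blocks_29_squares:
  "length (filter (\<lambda>d. fst d = g \<and> snd d \<in> squares_29) (concat (map differences blocks_29))) = 4"
proof -
  have "uniform_labels 4 (labelled_difference_table (\<lambda>z. z \<in> squares_29) blocks_29)"
    by (simp add: labelled_difference_table_def blocks_29_def simps_3 zero_prod_def)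
      (simp only: uniform_labels_def all_3_cubed ball_simps, simp add: simps_3)
  then show ?thesis
    unfolding uniform_labels_def length_filter_differences[where P = "\<lambda>z. z \<in> squares_29"] by blast
qed

lemma blocks_29_nonzero:
  "length (filter (\<lambda>d. fst d = g \<and> snd d \<noteq> 0) (concat (map differences blocks_29))) = 2 * 4"
proof -
  have "uniform_labels (2 * 4) (labelled_difference_table (\<lambda>z. z \<noteq> 0) blocks_29)"
    by (simp add: labelled_difference_table_def blocks_29_def simps_3 zero_prod_def)
      (simp only: uniform_labels_def all_3_cubed ball_simps, simp add: simps_3)
  then show ?thesis
    unfolding uniform_labels_def length_filter_differences[where P = "\<lambda>z. z \<noteq> 0"] by blast
qed

lemma card_blocks:
  "\<forall>B\<in>set blocks_17. distinct (map snd B) \<and> length B = 9"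
  "\<forall>B\<in>set blocks_29. distinct (map snd B) \<and> length B = 9"
  by (simp_all add: blocks_17_def blocks_29_def)

section \<open>Points as natural numbers, and the two designs\<close>

lemma two_design_nat:
  assumes "two_design v k l (UNIV :: 'a::finite set) A"
  shows "\<exists>(V :: nat set) \<A>. two_design v k l V \<A>"
proof -
  obtain f :: "'a \<Rightarrow> nat" where "inj f"
    using finite_imp_inj_to_nat_seg[of "UNIV :: 'a set"] by auto
  with two_design_image[OF assms] show ?thesis by blast
qed

theorem theorem2p8:
  "(\<exists>(V :: nat set) \<A>. two_design 459 9 4 V \<A>) \<and>
   (\<exists>(V :: nat set) \<A>. two_design 783 9 4 V \<A>)"
proof
  have "\<exists>A. two_design (27 * CARD(17)) 9 4 (UNIV :: ((3 \<times> 3 \<times> 3) \<times> 17) set) A"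
    by (rule two_design_from_strong_difference_family[OF unit_17 image_square_17[symmetric] card_squares_17
          card_blocks(1)[rule_format] blocks_17_squares blocks_17_nonzero planes_two_design])
  \<comment> \<open>Here \<open>27 * 17 = 459\<close>; the second design has
    \<open>27 * 29 = 783\<close> points.\<close>
  then show "\<exists>(V :: nat set) \<A>. two_design 459 9 4 V \<A>"
    using two_design_nat by fastforce
  have "\<exists>A. two_design (27 * CARD(29)) 9 4 (UNIV :: ((3 \<times> 3 \<times> 3) \<times> 29) set) A"
    by (rule two_design_from_strong_difference_family[OF unit_29 image_square_29[symmetric] card_squares_29
          card_blocks(2)[rule_format] blocks_29_squares blocks_29_nonzero planes_two_design])
  then show "\<exists>(V :: nat set) \<A>. two_design 783 9 4 V \<A>"
    using two_design_nat by fastforce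
qed

end
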